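(* Let $\lambda>0$. There exists a positive constant $C_0$ such that for any $y,z\in\mathbb{R}_+$ with $z<y$, $$R_{\Delta_\lambda}(y,z)\le -C_0\,\frac1{m_\lambda(I(y,y-z))}.$$
   Context: $\mathbb{R}_+:=(0,\infty)$, $\lambda>0$ is fixed, and $m_\lambda(E):=\int_E x^{2\lambda}\,dx$. For $x,r\in\mathbb{R}_+$, $I(x,r):=(x-r,x+r)\cap\mathbb{R}_+$. $R_{\Delta_\lambda}(y,z)$ denotes the kernel (with respect to $dm_\lambda(z)=z^{2\lambda}dz$) of the Riesz transform $R_{\Delta_\lambda}=\partial_x(\Delta_\lambda)^{-1/2}$ associated with the Bessel operator $\Delta_\lambda=-\frac{d^2}{dx^2}-\frac{2\lambda}{x}\frac{d}{dx}$; explicitly, for $y,z\in\mathbb{R}_+$ with $y\neq z$, $$R_{\Delta_\lambda}(y,z)=-\frac{2\lambda}{\pi}\int_0^\pi\frac{(y-z\cos\theta)(\sin\theta)^{2\lambda-1}}{(y^2+z^2-2yz\cos\theta)^{\lambda+1}}\,d\theta .$$ *)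

theory Defs
  imports "HOL-Analysis.Analysis"
begin

definition Rplus :: "real set" where
  "Rplus = {0<..}"

definition m_bessel :: "real \<Rightarrow> real measure" where
  "m_bessel lam = density (restrict_space lborel Rplus) (\<lambda>x. ennreal (x powr (2 * lam)))"

definition I_ball :: "real \<Rightarrow> real \<Rightarrow> real set" where
  "I_ball x r = {x - r<..<x + r} \<inter> Rplus"

text \<open>
  Kernel, with respect to \<open>m_bessel lam\<close>, of the Riesz transform
  \<open>\<partial>\<^sub>x (\<Delta>\<^sub>\<lambda>) powr (-1/2)\<close> associated with the Bessel operator
  \<open>\<Delta>\<^sub>\<lambda> = - d\<^sup>2/dx\<^sup>2 - (2\<lambda>/x) d/dx\<close>, given by its explicit integral formula.  It is meaningful for
  positive \<open>y \<noteq> z\<close>.  The integral is taken over the open interval because the integrand is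
  singular (but integrable) at the end points when \<open>lam < 1/2\<close>.
\<close>
definition riesz_kernel :: "real \<Rightarrow> real \<Rightarrow> real \<Rightarrow> real" where
  "riesz_kernel lam y z =
     - (2 * lam / pi) *
       (LINT \<theta>:{0<..<pi}|lborel.
          ((y - z * cos \<theta>) * (sin \<theta>) powr (2 * lam - 1)) /
          ((y\<^sup>2 + z\<^sup>2 - 2 * y * z * cos \<theta>) powr (lam + 1)))"

end

theory Submission
  imports Defs
begin

text \<open>
  Write \<open>d = y - z\<close>. The integrand is positive because \<open>y - z cos \<theta> \<ge> d\<close>. For \<open>\<theta>\<close> comparable
  to \<open>d / y\<close> the denominator is at most a multiple of \<open>d powr (2 * \<lambda> + 2)\<close>, since
  \<open>y\<^sup>2 + z\<^sup>2 - 2 y z cos \<theta> \<le> d\<^sup>2 + y\<^sup>2 \<theta>\<^sup>2\<close>, and \<open>sin \<theta>\<close> is comparable to \<open>d / y\<close>. So this range of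
  \<open>\<theta>\<close> alone contributes at least a multiple of \<open>1 / (d y powr (2 * \<lambda>))\<close>, which dominates
  \<open>1 / m\<^sub>\<lambda>(I(y, d))\<close> because the weight is at least \<open>y powr (2 * \<lambda>)\<close> on the right half of \<open>I(y, d)\<close>.
\<close>

lemma mult_cos_le_sin:
  fixes x :: real
  assumes "0 \<le> x" "x \<le> pi"
  shows "x * cos x \<le> sin x"
proof -
  have "sin 0 - 0 * cos 0 \<le> sin x - x * cos x"
  proof (rule DERIV_nonneg_imp_nondecreasing[OF assms(1)])
    fix t assume t: "0 \<le> t" "t \<le> x"
    have "((\<lambda>t. sin t - t * cos t) has_real_derivative t * sin t) (at t)"
      by (auto intro!: derivative_eq_intros simp: algebra_simps)
    moreover have "0 \<le> t * sin t"
      using t assms by (simp add: sin_ge_zero)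
    ultimately show "\<exists>D. ((\<lambda>t. sin t - t * cos t) has_real_derivative D) (at t) \<and> 0 \<le> D"
      by blast
  qed
  then show ?thesis by simp
qed

text \<open>Since \<open>cos x\<close> is nonnegative, the square of \<open>cos (x / 2)\<close> is
  at least 1/2. Writing sin x = 2 sin(x/2) cos(x/2) and applying \<open>mult_cos_le_sin\<close> at
  \<open>x / 2\<close> produces exactly x times that square.\<close>

lemma half_le_sin:
  fixes x :: real
  assumes "0 \<le> x" "x \<le> pi / 2"
  shows "x / 2 \<le> sin x"
proof -
  have c: "0 \<le> cos (x / 2)" "0 \<le> cos x"
    using assms by (auto intro!: cos_ge_zero)
  have "cos x = 2 * (cos (x / 2))\<^sup>2 - 1"
    using cos_double_cos[of "x / 2"] by simp
  then have "1 / 2 \<le> (cos (x / 2))\<^sup>2"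
    using c by simp
  then have "x * (1 / 2) \<le> x * (cos (x / 2))\<^sup>2"
    using assms by (intro mult_left_mono) auto
  also have "\<dots> = 2 * (x / 2 * cos (x / 2)) * cos (x / 2)"
    by (simp add: power2_eq_square)
  also have "\<dots> \<le> 2 * sin (x / 2) * cos (x / 2)"
    using assms c mult_cos_le_sin[of "x / 2"] by (intro mult_right_mono mult_left_mono) auto
  also have "\<dots> = sin x"
    using sin_double[of "x / 2"] by simp
  finally show ?thesis by simp
qed

lemma one_minus_cos_le:
  fixes x :: real
  shows "1 - cos x \<le> x\<^sup>2 / 2"
proof -
  have "(sin (x / 2))\<^sup>2 \<le> (x / 2)\<^sup>2"
    using abs_sin_x_le_abs_x[of "x / 2"] by (simp only: abs_le_square_iff)
  then show ?thesis
    using cos_double_sin[of "x / 2"] by (simp add: power_divide)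
qed

text \<open>Both sides are invariant under u -> 1 - u, so u \<le> 1/2 suffices. The product form is
  chosen because its powers are Beta integrands, which majorise negative powers of the sine near
  both zeros at once.\<close>

lemma sin_ge_parabola:
  fixes u :: real
  assumes "0 \<le> u" "u \<le> 1"
  shows "u * (1 - u) \<le> sin (pi * u)"
proof -
  have *: "v * (1 - v) \<le> sin (pi * v)" if "0 \<le> v" "v \<le> 1 / 2" for v :: real
  proof -
    have "v * (1 - v) \<le> v * 1"
      using that by (intro mult_left_mono) auto
    also have "\<dots> \<le> pi * v / 2"
      using mult_right_mono[of 2 pi v] pi_ge_two that by simp
    also have "\<dots> \<le> sin (pi * v)"
      using that by (intro half_le_sin) auto
    finally show ?thesis .
  qed
  show ?thesis
  proof (cases "u \<le> 1 / 2")
    case True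
    then show ?thesis using * assms by simp
  next
    case False
    then have "(1 - u) * u \<le> sin (pi * (1 - u))"
      using *[of "1 - u"] assms by simp
    also have "\<dots> = sin (pi * u)"
      by (simp add: right_diff_distrib)
    finally show ?thesis by (simp add: mult.commute)
  qed
qed

text \<open>For p \<ge> 0 the function is bounded by 1. For negative p the parabola bound reverses
  under the power, and after x = pi * u a Beta integrand with both parameters p + 1 > 0
  dominates.\<close>

lemma set_integrable_sin_powr:
  fixes p :: real
  assumes "p > -1"
  shows "set_integrable lborel {0<..<pi} (\<lambda>x. sin x powr p)"
proof (cases "p \<ge> 0")
  case True
  have "set_integrable lborel {0<..<pi} (\<lambda>_. 1 :: real)"
    by (simp add: set_integrable_def)
  then show ?thesis
  proof (rule set_integrable_bound)
    show "AE x in lborel. x \<in> {0<..<pi} \<longrightarrow> norm (sin x powr p) \<le> norm (1 :: real)"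
      using True by (auto intro!: AE_I2 powr_le1 simp: sin_ge_zero)
  qed (simp add: set_borel_measurable_def)
next
  case False
  define f where "f = (\<lambda>t. indicator {0..1} t *\<^sub>R (t powr p * (1 - t) powr p) :: real)"
  have "integrable lborel f"
    using integrable_Beta[of "p + 1" "p + 1"] assms by (simp add: set_integrable_def f_def)
  \<comment> \<open>The argument \<open>0 + 1 / pi * x\<close> is u = x / pi, written in the form of
    the affine change of variables.\<close>
  then have int: "integrable lborel (\<lambda>x. f (0 + 1 / pi * x))"
    by (rule lborel_integrable_real_affine) simp
  show ?thesis
    unfolding set_integrable_def
  proof (rule Bochner_Integration.integrable_bound[OF int])
    show "AE x in lborel. norm (indicat_real {0<..<pi} x *\<^sub>R sin x powr p) \<le> norm (f (0 + 1 / pi * x))"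
    proof (rule AE_I2)
      fix x :: real
      show "norm (indicat_real {0<..<pi} x *\<^sub>R sin x powr p) \<le> norm (f (0 + 1 / pi * x))"
      proof (cases "x \<in> {0<..<pi}")
        case True
        define u where "u = x / pi"
        have u: "0 < u" "u < 1" "x = pi * u"
          using True by (auto simp: u_def field_simps)
        have "sin x powr p \<le> (u * (1 - u)) powr p"
          using sin_ge_parabola[of u] u False by (intro powr_mono2') auto
        also have "\<dots> = u powr p * (1 - u) powr p"
          using u by (simp add: powr_mult)
        finally show ?thesis
          using True u by (simp add: f_def)
      qed simp
    qed
  qed simp
qed

lemma measure_I_ball_ge:
  assumes lam: "lam > 0" and d: "0 < d" "d < y"
  shows "d * y powr (2 * lam) \<le> measure (m_bessel lam) (I_ball y d)"
proof -
  have em: "emeasure (m_bessel lam) (I_ball y d) =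
      (\<integral>\<^sup>+x. ennreal (x powr (2 * lam)) * indicator {y - d<..<y + d} x \<partial>lborel)"
  proof -
    have "I_ball y d = {y - d<..<y + d}"
      using d by (auto simp: I_ball_def Rplus_def)
    moreover have "{y - d<..<y + d} \<in> sets (restrict_space lborel Rplus)"
      using d by (auto simp: sets_restrict_space_iff Rplus_def)
    ultimately have "emeasure (m_bessel lam) (I_ball y d) =
        (\<integral>\<^sup>+x. ennreal (x powr (2 * lam)) * indicator {y - d<..<y + d} x
          \<partial>restrict_space lborel Rplus)"
      unfolding m_bessel_def
      by (simp add: emeasure_density measurable_restrict_space1)
    also have "\<dots> = (\<integral>\<^sup>+x. ennreal (x powr (2 * lam)) * indicator {y - d<..<y + d} x *
        indicator Rplus x \<partial>lborel)"
      by (rule nn_integral_restrict_space) (simp add: Rplus_def)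
    also have "\<dots> = (\<integral>\<^sup>+x. ennreal (x powr (2 * lam)) * indicator {y - d<..<y + d} x \<partial>lborel)"
      using d by (intro nn_integral_cong) (auto simp: Rplus_def split: split_indicator)
    finally show ?thesis .
  qed
  \<comment> \<open>Finiteness has to be secured first: \<open>measure\<close> is 0 by convention on
    a set of infinite \<open>emeasure\<close>. Here x < y + d < 2 * y bounds the weight.\<close>
  have "emeasure (m_bessel lam) (I_ball y d) \<le>
      (\<integral>\<^sup>+x. ennreal ((2 * y) powr (2 * lam)) * indicator {y - d<..<y + d} x \<partial>lborel)"
    unfolding em using d lam
    by (intro nn_integral_mono) (auto intro!: ennreal_leI powr_mono2 split: split_indicator)
  also have "\<dots> < \<infinity>"
    using d by (simp add: nn_integral_cmult_indicator ennreal_mult_less_top)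
  finally have fin: "emeasure (m_bessel lam) (I_ball y d) \<noteq> \<infinity>"
    by simp
  have "ennreal (y powr (2 * lam) * d) =
      (\<integral>\<^sup>+x. ennreal (y powr (2 * lam)) * indicator {y<..<y + d} x \<partial>lborel)"
    using d by (simp add: nn_integral_cmult_indicator ennreal_mult')
  also have "\<dots> \<le> emeasure (m_bessel lam) (I_ball y d)"
    unfolding em using d lam
    by (intro nn_integral_mono) (auto intro!: ennreal_leI powr_mono2 split: split_indicator)
  also have "\<dots> = ennreal (measure (m_bessel lam) (I_ball y d))"
    using fin by (intro emeasure_eq_ennreal_measure) simp
  finally show ?thesis
    by (simp add: mult.commute)
qed

text \<open>The exponent 2\<lambda> - 1 may have either sign. The least value of the power on [a, 1]
  is at a when p \<ge> 0 and at 1 when p < 0; the minimum covers both.\<close>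

lemma powr_ge_min_one:
  fixes a s p :: real
  assumes "0 < a" "a \<le> s" "s \<le> 1"
  shows "min 1 (a powr p) \<le> s powr p"
proof (cases "p \<ge> 0")
  case True
  then have "a powr p \<le> s powr p"
    using assms by (intro powr_mono2) auto
  then show ?thesis by simp
next
  case False
  then have "1 powr p \<le> s powr p"
    using assms by (intro powr_mono2') auto
  then show ?thesis by simp
qed

text \<open>The integrand is at least \<open>c\<close> on (e/2, e), where e = d/y, and
  \<open>k\<close> comes from \<open>c * (e / 2)\<close>. The numerator of \<open>k\<close> bounds
  (sin \<theta> / e) powr p from below; 4 * 2 powr \<lambda> is the 2 from the length e/2 times the
  2 powr (\<lambda> + 1) from the bound 2 d^2 on the denominator's base.\<close>

lemma riesz_integral_ge:
  fixes lam y z d :: real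
  defines "k \<equiv> min 1 ((1 / 4) powr (2 * lam - 1)) / (4 * 2 powr lam)"
  assumes lam: "lam > 0" and z: "0 < z" "z < y" and d: "d = y - z"
  shows "k / (d * y powr (2 * lam)) \<le>
    (LINT \<theta>:{0<..<pi}|lborel.
       ((y - z * cos \<theta>) * (sin \<theta>) powr (2 * lam - 1)) /
       ((y\<^sup>2 + z\<^sup>2 - 2 * y * z * cos \<theta>) powr (lam + 1)))"
proof -
  define p where "p = 2 * lam - 1"
  define m where "m = min 1 ((1 / 4) powr p)"
  define N where "N = (\<lambda>\<theta>. y - z * cos \<theta>)"
  define D where "D = (\<lambda>\<theta>. y\<^sup>2 + z\<^sup>2 - 2 * y * z * cos \<theta>)"
  define F where "F = (\<lambda>\<theta>. N \<theta> * sin \<theta> powr p / D \<theta> powr (lam + 1))"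
  define e where "e = d / y"
  define c where "c = d * (m * e powr p) / (2 * d\<^sup>2) powr (lam + 1)"
  have d0: "0 < d" "d < y" and e: "0 < e" "e < 1"
    using z d by (auto simp: e_def)
  have m0: "0 < m"
    by (simp add: m_def)
  have D_eq: "D \<theta> = d\<^sup>2 + 2 * y * z * (1 - cos \<theta>)" for \<theta>
    by (simp add: D_def d power2_eq_square algebra_simps)
  have D_ge: "d\<^sup>2 \<le> D \<theta>" for \<theta>
    using z by (simp add: D_eq)
  have D_le: "D \<theta> \<le> d\<^sup>2 + (y * \<theta>)\<^sup>2" for \<theta>
  proof -
    have "2 * y * z * (1 - cos \<theta>) \<le> 2 * y * y * (\<theta>\<^sup>2 / 2)"
      using z one_minus_cos_le[of \<theta>] by (intro mult_mono) auto
    then show ?thesis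
      by (simp add: D_eq power2_eq_square algebra_simps)
  qed
  have zc: "z * cos \<theta> \<le> z" "- z \<le> z * cos \<theta>" for \<theta>
    using z mult_left_mono[OF cos_le_one[of \<theta>], of z] mult_left_mono[OF cos_ge_minus_one[of \<theta>], of z]
    by auto
  have N_ge: "d \<le> N \<theta>" and N_le: "N \<theta> \<le> y + z" for \<theta>
    using zc[of \<theta>] by (auto simp: N_def d)
  have F_nonneg: "0 \<le> F \<theta>" for \<theta>
    using N_ge[of \<theta>] d0 by (simp add: F_def)
  \<comment> \<open>This upper bound serves only integrability: as D \<ge> d^2 > 0, the sine power
    is the only possible source of a singularity.\<close>
  have F_le: "F \<theta> \<le> (y + z) / (d\<^sup>2) powr (lam + 1) * sin \<theta> powr p" for \<theta>
  proof -
    have "F \<theta> \<le> (y + z) * sin \<theta> powr p / (d\<^sup>2) powr (lam + 1)"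
      unfolding F_def using N_ge[of \<theta>] N_le[of \<theta>] D_ge[of \<theta>] d0 z lam
      by (intro frac_le mult_right_mono powr_mono2) auto
    then show ?thesis by simp
  qed
  have F_int: "set_integrable lborel {0<..<pi} F"
  proof (rule set_integrable_bound)
    show "set_integrable lborel {0<..<pi} (\<lambda>\<theta>. (y + z) / (d\<^sup>2) powr (lam + 1) * sin \<theta> powr p)"
      using set_integrable_sin_powr[of p] lam by (simp add: p_def)
    show "set_borel_measurable lborel {0<..<pi} F"
      unfolding set_borel_measurable_def F_def N_def D_def by measurable
    show "AE \<theta> in lborel. \<theta> \<in> {0<..<pi} \<longrightarrow>
        norm (F \<theta>) \<le> norm ((y + z) / (d\<^sup>2) powr (lam + 1) * sin \<theta> powr p)"
    proof (intro AE_I2 impI)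
      fix \<theta> :: real
      show "norm (F \<theta>) \<le> norm ((y + z) / (d\<^sup>2) powr (lam + 1) * sin \<theta> powr p)"
        using F_le[of \<theta>] F_nonneg[of \<theta>] unfolding real_norm_def by linarith
    qed
  qed
  \<comment> \<open>Staying above e/2 keeps sin \<theta> / e away from 0: it is at least \<theta> /
    (2 e) > 1/4, and at most 1 because sin \<theta> \<le> \<theta> < e.\<close>
  have F_ge: "c \<le> F \<theta>" if "\<theta> \<in> {e / 2<..<e}" for \<theta>
  proof -
    have \<theta>: "0 < \<theta>" "\<theta> < e" "e / 2 < \<theta>" "\<theta> \<le> pi / 2"
      using that e pi_ge_two by auto
    have "m \<le> (sin \<theta> / e) powr p"
      unfolding m_def
    proof (rule powr_ge_min_one)
      show "1 / 4 \<le> sin \<theta> / e"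
        using half_le_sin[of \<theta>] \<theta> e by (simp add: field_simps)
      show "sin \<theta> / e \<le> 1"
        using sin_x_le_x[of \<theta>] \<theta> e by (simp add: field_simps)
    qed simp
    then have "m * e powr p \<le> (sin \<theta> / e) powr p * e powr p"
      by (rule mult_right_mono) simp
    also have "\<dots> = sin \<theta> powr p"
      using \<theta> e sin_ge_zero[of \<theta>] by (simp add: powr_divide)
    finally have s: "m * e powr p \<le> sin \<theta> powr p" .
    have "y * \<theta> \<le> d"
      using \<theta> z by (simp add: e_def field_simps)
    then have "(y * \<theta>)\<^sup>2 \<le> d\<^sup>2"
      using \<theta> z by (intro power_mono) auto
    then have "D \<theta> \<le> 2 * d\<^sup>2"
      using D_le[of \<theta>] by simp
    \<comment> \<open>Positivity of the denominator is what allows the quotient to be bounded below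
      through the upper bound on D.\<close>
    moreover have "0 < D \<theta>"
      using D_ge[of \<theta>] d0 by (smt (verit) zero_less_power)
    ultimately show ?thesis
      unfolding F_def c_def using N_ge[of \<theta>] s d0 e m0 lam
      by (intro frac_le mult_mono powr_mono2) auto
  qed
  have "k / (d * y powr (2 * lam)) = c * (e / 2)"
  proof -
    have "(2 * d\<^sup>2) powr (lam + 1) = 2 * 2 powr lam * (d powr (2 * lam) * d\<^sup>2)"
      using d0 by (simp add: powr_mult powr_add powr_powr flip: powr_numeral)
    moreover have "e powr p * e = d powr (2 * lam) / y powr (2 * lam)"
    proof -
      have "e powr p * e = e powr p * e powr 1"
        using e by simp
      also have "\<dots> = e powr (2 * lam)"
        by (simp only: p_def flip: powr_add) simp
      finally show ?thesis
        using d0 by (simp add: e_def powr_divide)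
    qed
    moreover have "c * (e / 2) = d * m * (e powr p * e) / (2 * (2 * d\<^sup>2) powr (lam + 1))"
      by (simp add: c_def)
    ultimately have "c * (e / 2) = d * m * (d powr (2 * lam) / y powr (2 * lam)) /
        (2 * (2 * 2 powr lam * (d powr (2 * lam) * d\<^sup>2)))"
      by simp
    also have "\<dots> = m / (4 * 2 powr lam) / (d * y powr (2 * lam))"
      using d0 by (simp add: field_simps power2_eq_square)
    finally show ?thesis
      by (simp add: k_def m_def p_def)
  qed
  also have "c * (e / 2) = (LINT \<theta>:{e / 2<..<e}|lborel. c)"
    using e by (simp add: set_lebesgue_integral_def)
  \<comment> \<open>Since e < 1 < pi, the short interval lies inside (0, pi); the rest of the
    integral is dropped because F is nonnegative.\<close>
  also have "\<dots> \<le> (LINT \<theta>:{0<..<pi}|lborel. F \<theta>)"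
    unfolding set_lebesgue_integral_def
  proof (rule integral_mono)
    show "integrable lborel (\<lambda>\<theta>. indicat_real {e / 2<..<e} \<theta> *\<^sub>R c)"
      using e by (intro integrable_scaleR_left integrable_real_indicator) auto
    show "integrable lborel (\<lambda>\<theta>. indicat_real {0<..<pi} \<theta> *\<^sub>R F \<theta>)"
      using F_int by (simp add: set_integrable_def)
    show "indicat_real {e / 2<..<e} \<theta> *\<^sub>R c \<le> indicat_real {0<..<pi} \<theta> *\<^sub>R F \<theta>" for \<theta>
      using F_ge[of \<theta>] F_nonneg[of \<theta>] e pi_ge_two by (auto split: split_indicator)
  qed
  finally show ?thesis
    by (simp add: F_def N_def D_def p_def)
qed

theorem proposition2p5:
  fixes lam :: real
  assumes "lam > 0"
  shows "\<exists>C0::real. C0 > 0 \<and>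
    (\<forall>y\<in>Rplus. \<forall>z\<in>Rplus. z < y \<longrightarrow>
      riesz_kernel lam y z \<le> - C0 * (1 / measure (m_bessel lam) (I_ball y (y - z))))"
proof -
  define k where "k = min 1 ((1 / 4) powr (2 * lam - 1)) / (4 * 2 powr lam)"
  have k: "0 < k"
    by (simp add: k_def)
  \<comment> \<open>The witness is \<open>k\<close> times the prefactor 2\<lambda>/pi of the kernel,
    whose minus sign turns the lower bound for the integral into an upper bound.\<close>
  have "riesz_kernel lam y z \<le>
      - (2 * lam / pi * k) * (1 / measure (m_bessel lam) (I_ball y (y - z)))"
    if yz: "y \<in> Rplus" "z \<in> Rplus" "z < y" for y z
  proof -
    define J where "J = (LINT \<theta>:{0<..<pi}|lborel.
       ((y - z * cos \<theta>) * (sin \<theta>) powr (2 * lam - 1)) /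
       ((y\<^sup>2 + z\<^sup>2 - 2 * y * z * cos \<theta>) powr (lam + 1)))"
    have z: "0 < z" "z < y"
      using yz by (auto simp: Rplus_def)
    have "(y - z) * y powr (2 * lam) \<le> measure (m_bessel lam) (I_ball y (y - z))"
      using z assms by (intro measure_I_ball_ge) auto
    then have "k / measure (m_bessel lam) (I_ball y (y - z)) \<le> k / ((y - z) * y powr (2 * lam))"
      using z k by (intro divide_left_mono mult_pos_pos) (auto intro: less_le_trans[rotated])
    also have "\<dots> \<le> J"
      unfolding J_def k_def using assms z by (intro riesz_integral_ge) auto
    finally have "2 * lam / pi * (k / measure (m_bessel lam) (I_ball y (y - z))) \<le> 2 * lam / pi * J"
      using assms by (intro mult_left_mono) auto
    then show ?thesis
      by (simp add: riesz_kernel_def J_def)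
  qed
  moreover have "0 < 2 * lam / pi * k"
    using assms k by simp
  ultimately show ?thesis
    by blast
qed

end
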